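(* For any $a\in\mathbb{N}$ and $b\in\mathbb{N}_0$, $$t^{\star}(\{2\}^{a},1,\{2\}^{b})=-\frac{4}{\pi}t(\overline{2a+2b+2})-\frac{8}{\pi}t(2a+1,\overline{2b+1})$$ $$=-\frac{4}{\pi}\sum_{r=1}^{a+b}2^{-2r}\left[\binom{2r}{2a}+\binom{2r}{2b}(1-2^{-2r})\right]\zeta(2r+1)\,t(\overline{2a+2b+1-2r})-\delta_{b,0}\frac{4\log2}{\pi}t(\overline{2a+1}),$$ where $\delta_{b,0}$ is the Kronecker delta.
   Context: $t^{\star}(\boldsymbol{s})=\sum_{k_1\geq\cdots\geq k_r\geq1}\prod_{j}(2k_j-1)^{-s_j}$ for an index with $s_1>1$; $\{2\}^a$ is $2$ repeated $a$ times. Alternating multiple $t$-values: $t(\boldsymbol{s};\boldsymbol{\sigma})=\sum_{k_1>\cdots>k_r\geq1}\prod_{j}\frac{\sigma_j^{k_j}}{(2k_j-1)^{s_j}}$, where a bar over $s_j$ means $\sigma_j=-1$ and no bar means $\sigma_j=1$. $\zeta$ is the Riemann zeta function. *)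

theory Defs
  imports "HOL-Analysis.Analysis"
begin

fun tstar_part :: "nat \<Rightarrow> nat list \<Rightarrow> real" where
  "tstar_part N [] = 1"
| "tstar_part N (s # ss) =
     (\<Sum>k = 1..N. (1 / (2 * real k - 1) ^ s) * tstar_part k ss)"

definition tstar :: "nat list \<Rightarrow> real" where
  "tstar s = lim (\<lambda>N. tstar_part N s)"

(* Truncated alternating multiple t-sum: sum over N >= k1 > k2 > ... > kr >= 1
   of prod_j sigma_j^k_j / (2 k_j - 1)^s_j.  An index entry (s, True) means
   a barred s (sigma = -1), (s, False) means unbarred (sigma = 1). *)
fun tval_part :: "nat \<Rightarrow> (nat \<times> bool) list \<Rightarrow> real" where
  "tval_part N [] = 1"
| "tval_part N ((s, bar) # ss) =
     (\<Sum>k = 1..N. ((if bar then (-1) ^ k else 1) / (2 * real k - 1) ^ s)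
                   * tval_part (k - 1) ss)"

definition tval :: "(nat \<times> bool) list \<Rightarrow> real" where
  "tval s = lim (\<lambda>N. tval_part N s)"

definition rzeta :: "nat \<Rightarrow> real" where
  "rzeta n = (\<Sum>k. 1 / real (Suc k) ^ n)"

end

theory Submission
  imports Defs "HOL-Real_Asymp.Real_Asymp"
begin

text \<open>
  Write o(k) = 2k - 1 and c(l) = (-1)^l / o(l)^(2b+1). Let w(n,k) be the absolute values of the
  coefficients in the partial fraction expansion of the product over j \<le> n of
  1 / (1 - x^2 / o(j)^2) with respect to 1 / (1 - x^2 / o(k)^2). By induction the truncated
  t-star-sum equals minus the sum over k \<le> n of w(n,k) V(k) / o(k)^(2a), where V(k) is the sum of
  c(l) over 1 - k \<le> l \<le> k - 1. Since w(n,k) tends to 4 / (pi o(k)) by Wallis' product, dominated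
  convergence gives -4/pi times the series X of V(k) / o(k)^(2a+1), which is the first formula.

  For the second formula, c(1 - l) = c(l) while o(1 - k) = - o(k), so X is the sum over p \<ge> 1 of
  the sum over all integers k of c(k - p) / o(k)^(2a+1); the double series need not converge absolutely
  (b = 0), but bounded partial sums of c suffice to interchange. Expanding
  1 / (o(k)^(2a+1) (o(k) - 2p)^(2b+1)) into partial fractions makes each inner sum a combination of
  t(bar(j)) / (2p)^(2a+2b+2-j) with odd j, and summing over p produces the zeta values.
\<close>

subsection \<open>Truncated t-star-sums\<close>

definition star_weight_const :: "nat \<Rightarrow> real" where
  "star_weight_const n = 4 * (\<Prod>j = 1..n. (2 * real j - 1)\<^sup>2 / 4)"

text \<open>This is the product over j \<le> n, j \<noteq> k, of o(j)^2 / |o(j)^2 - o(k)^2| in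
  closed form. Since o(j)^2 - o(k)^2 = 4 (j - k) (j + k - 1), the product collapses to factorials
  and n - 1 powers of 4, which explains the leading 4 in \<open>star_weight_const\<close>. The value
  0 beyond n lets sums over k run past n.\<close>

definition star_weight :: "nat \<Rightarrow> nat \<Rightarrow> real" where
  "star_weight n k =
     (if k \<le> n then star_weight_const n / ((2 * real k - 1) * fact (n - k) * fact (n + k - 1)) else 0)"

lemma star_weight_const_Suc:
  "star_weight_const (Suc n) = star_weight_const n * (2 * real n + 1)\<^sup>2 / 4"
  by (simp add: star_weight_const_def add_ac)

lemma star_weight_const_pos: "star_weight_const n > 0"
  by (auto simp: star_weight_const_def intro!: prod_pos)

lemma odd_real_nonzero: "2 * real k - 1 \<noteq> 0"
proof
  assume "2 * real k - 1 = 0"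
  then have "real (2 * k) = real 1" by simp
  then have "2 * k = 1" by (simp only: of_nat_eq_iff)
  then show False by presburger
qed

lemma star_weight_nonneg: "k \<ge> 1 \<Longrightarrow> star_weight n k \<ge> 0"
  using star_weight_const_pos[of n] by (auto simp: star_weight_def intro!: divide_nonneg_nonneg)

text \<open>Enlarging n multiplies the product that is being expanded by one more factor 1 / (1 -
  x^2 / o(n+1)^2), which changes the coefficient at k by its value at x = o(k). At k = n + 1 the
  bracket vanishes, in agreement with the cut-off.\<close>

lemma star_weight_Suc_left:
  assumes "k \<ge> 1"
  shows "star_weight (Suc n) k * (1 - (2 * real k - 1)\<^sup>2 / (2 * real (Suc n) - 1)\<^sup>2) = star_weight n k"
proof -
  consider "k \<le> n" | "k = Suc n" | "k > Suc n" by linarith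
  then show ?thesis
  proof cases
    case 1
    obtain j where j: "k = Suc j" using assms by (cases k) auto
    obtain m where m: "n = k + m" using 1 le_Suc_ex by blast
    define F where "F = (fact (Suc (2 * j + m)) :: real)"
    have e: "n - k = m" "Suc n - k = Suc m" "n + k - 1 = Suc (2 * j + m)"
      "Suc n + k - 1 = Suc (Suc (2 * j + m))" "k \<le> Suc n" using j m by auto
    have f: "fact (Suc (Suc (2 * j + m))) = (2 * real j + real m + 2) * F"
      unfolding F_def by (subst fact_Suc) (simp add: algebra_simps)
    have g: "(fact (Suc m) :: real) = (real m + 1) * fact m" by (simp add: algebra_simps)
    have F: "F \<noteq> 0" by (simp add: F_def)
    define q where "q = 2 * real n + 1"
    have q: "q \<noteq> 0" "2 * real (Suc n) - 1 = q" by (simp_all add: q_def)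
    define x where "x = 2 * real k - 1"
    have x: "x \<noteq> 0" unfolding x_def by (rule odd_real_nonzero)
    \<comment> \<open>The two factors are n + 1 - k and n + k; they cancel the top factors of the
      two factorials.\<close>
    have num: "q\<^sup>2 - x\<^sup>2 = 4 * (real m + 1) * (2 * real j + real m + 2)"
      unfolding q_def x_def m j by (simp add: power2_eq_square algebra_simps)
    have r: "1 - x\<^sup>2 / q\<^sup>2 = (q\<^sup>2 - x\<^sup>2) / q\<^sup>2" using q by (simp add: diff_divide_distrib)
    have "star_weight (Suc n) k * (1 - x\<^sup>2 / q\<^sup>2)
      = star_weight_const n * (q\<^sup>2 - x\<^sup>2) / 4 / (x * ((real m + 1) * fact m) * ((2 * real j + real m + 2) * F))"
      unfolding star_weight_def e f g star_weight_const_Suc x_def[symmetric] q_def[symmetric]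
      using x q(1) e(5) by (simp add: r)
    also have "\<dots> = star_weight_const n / (x * fact m * F)"
      unfolding num using x F by (simp add: divide_simps add_nonneg_eq_0_iff)
    also have "\<dots> = star_weight n k"
      unfolding star_weight_def e x_def F_def using 1 by simp
    finally show ?thesis unfolding x_def q(2) .
  next
    case 2
    then show ?thesis using odd_real_nonzero[of k] by (simp add: star_weight_def)
  qed (simp add: star_weight_def)
qed

text \<open>The induction step shared by all evaluations of truncated sums: the increment from n to
  n + 1 is a weighted sum with an extra o(k)^2, divided by o(n+1)^2. It has to be matched with the
  new outermost term of \<open>tstar_part\<close>.\<close>

lemma sum_star_weight_Suc:
  "(\<Sum>k = 1..Suc n. star_weight (Suc n) k * f k) =
   (\<Sum>k = 1..n. star_weight n k * f k) +
   (\<Sum>k = 1..Suc n. star_weight (Suc n) k * ((2 * real k - 1)\<^sup>2 * f k)) / (2 * real (Suc n) - 1)\<^sup>2"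
proof -
  have "(\<Sum>k = 1..n. star_weight n k * f k) = (\<Sum>k = 1..Suc n. star_weight n k * f k)"
    by (simp add: star_weight_def)
  also have "\<dots> = (\<Sum>k = 1..Suc n. star_weight (Suc n) k * (1 - (2 * real k - 1)\<^sup>2 / (2 * real (Suc n) - 1)\<^sup>2) * f k)"
    by (rule sum.cong) (use star_weight_Suc_left in auto)
  also have "\<dots> = (\<Sum>k = 1..Suc n. star_weight (Suc n) k * f k) -
   (\<Sum>k = 1..Suc n. star_weight (Suc n) k * ((2 * real k - 1)\<^sup>2 * f k)) / (2 * real (Suc n) - 1)\<^sup>2"
    unfolding sum_divide_distrib sum_subtractf[symmetric]
    by (rule sum.cong) (auto simp: algebra_simps)
  finally show ?thesis by simp
qed

text \<open>Dividing \<open>f\<close> by o(k)^2 cancels the extra square in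
  \<open>sum_star_weight_Suc\<close>, so the increment is exactly the new term of a leading entry 2.
  The hypothesis starts at n = 1 because for \<open>ss = []\<close> and n = 0 it would read 1 =
  0.\<close>

lemma tstar_part_2_Cons:
  assumes "\<And>n. n \<ge> 1 \<Longrightarrow> tstar_part n ss = (\<Sum>k = 1..n. star_weight n k * f k)"
  shows "tstar_part n (2 # ss) = (\<Sum>k = 1..n. star_weight n k * (f k / (2 * real k - 1)\<^sup>2))"
proof (induction n)
  case (Suc n)
  have "(2 * real k - 1)\<^sup>2 * (f k / (2 * real k - 1)\<^sup>2) = f k" for k
    using odd_real_nonzero[of k] by simp
  then show ?case
    by (subst sum_star_weight_Suc) (use Suc assms[of "Suc n"] in simp)
qed simp

lemma tstar_part_replicate_2_append:
  assumes "\<And>n. n \<ge> 1 \<Longrightarrow> tstar_part n ss = (\<Sum>k = 1..n. star_weight n k * f k)" and "n \<ge> 1"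
  shows "tstar_part n (replicate a 2 @ ss) = (\<Sum>k = 1..n. star_weight n k * (f k / (2 * real k - 1) ^ (2 * a)))"
  using assms(2)
proof (induction a arbitrary: n)
  case (Suc a)
  show ?case
    using tstar_part_2_Cons[OF Suc.IH, of n]
    by (simp add: power2_eq_square mult_ac)
qed (use assms in simp)

text \<open>A potential for the weights: up to a constant, its difference in k is w(n,k) o(k)^2 and
  its sum over two neighbours is o(n) w(n,k) o(k). It vanishes beyond n, so upper boundary terms
  disappear.\<close>

definition inv_fact_pair :: "nat \<Rightarrow> nat \<Rightarrow> real" where
  "inv_fact_pair n k = (if k \<le> n then 1 / (fact (n - k) * fact (n + k - 2)) else 0)"

text \<open>Over this common denominator the numerators differ by 2k - 1 and add up to 2n -
  1.\<close>

lemma inv_fact_pair_eq: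
  assumes "1 \<le> k" "k \<le> n"
  shows "inv_fact_pair n k = (real n + real k - 1) / (fact (n - k) * fact (n + k - 1))"
    and "inv_fact_pair n (Suc k) = (real n - real k) / (fact (n - k) * fact (n + k - 1))"
proof -
  obtain j where j: "k = Suc j" using assms by (cases k) auto
  obtain m where m: "n = k + m" using assms le_Suc_ex by blast
  define F where "F = (fact (2 * j + m) :: real)"
  have e: "n - k = m" "n + k - 2 = 2 * j + m" "n + k - 1 = Suc (2 * j + m)"
    "n + Suc k - 2 = Suc (2 * j + m)" "real n + real k - 1 = 2 * real j + real m + 1"
    "real n - real k = real m"
    using j m by auto
  have f: "fact (Suc (2 * j + m)) = (2 * real j + real m + 1) * F"
    unfolding F_def by (subst fact_Suc) (simp add: algebra_simps)
  have F: "F \<noteq> 0" by (simp add: F_def)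
  have nz: "2 * real j + real m + 1 \<noteq> 0" by linarith
  show "inv_fact_pair n k = (real n + real k - 1) / (fact (n - k) * fact (n + k - 1))"
    unfolding inv_fact_pair_def e f F_def[symmetric] using assms F nz by simp
  show "inv_fact_pair n (Suc k) = (real n - real k) / (fact (n - k) * fact (n + k - 1))"
  proof (cases m)
    case 0
    then show ?thesis using m by (simp add: inv_fact_pair_def)
  next
    case (Suc i)
    then have "n - Suc k = i" "Suc k \<le> n" using m by auto
    then show ?thesis
      unfolding inv_fact_pair_def e f F_def[symmetric] using F nz Suc by simp
  qed
qed

section \<open>Base cases: the index tails {2}^b and 1, {2}^b\<close>

lemma sum_telescope_down: "(\<Sum>k = 1..n. g k - g (Suc k)) = g 1 - (g (Suc n) :: real)"
  by (induction n) auto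

text \<open>The partial fraction expansion at x = 0. In the induction the increment given by
  \<open>sum_star_weight_Suc\<close> telescopes to 0.\<close>

lemma alternating_sum_star_weight:
  assumes "n \<ge> 1"
  shows "(\<Sum>k = 1..n. star_weight n k * (- ((-1) ^ k))) = 1"
  using assms
proof (induction n rule: dec_induct)
  case base
  show ?case by (simp add: star_weight_def star_weight_const_def)
next
  case (step n)
  let ?N = "Suc n"
  define d where "d = inv_fact_pair ?N"
  \<comment> \<open>The factor k - 1 makes g(1) vanish. By (k - 1)(n + k) + k (n + 1 - k) = n (2k -
    1) the difference of g has the required numerator after division by n, which is positive
    here.\<close>
  define g where "g = (\<lambda>k. - ((-1) ^ k) * (real k - 1) / real n * d k)"
  have "star_weight ?N k * ((2 * real k - 1)\<^sup>2 * (- ((-1) ^ k))) = star_weight_const ?N * (g k - g (Suc k))"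
    if "k \<in> {1..?N}" for k
  proof -
    define F where "F = (fact (?N - k) * fact (?N + k - 1) :: real)"
    have F: "F \<noteq> 0" by (simp add: F_def)
    have k: "1 \<le> k" "k \<le> ?N" using that by auto
    note D = inv_fact_pair_eq[OF k, folded d_def F_def]
    have "g k - g (Suc k) = - ((-1) ^ k) * (2 * real k - 1) / F"
      unfolding g_def D using F step.hyps by (simp add: field_simps)
    moreover have "star_weight ?N k = star_weight_const ?N / ((2 * real k - 1) * F)"
      using k by (simp add: star_weight_def F_def mult.assoc)
    ultimately show ?thesis
      using F odd_real_nonzero[of k] by (simp add: power2_eq_square)
  qed
  then have "(\<Sum>k = 1..?N. star_weight ?N k * ((2 * real k - 1)\<^sup>2 * (- ((-1) ^ k))))
      = star_weight_const ?N * (\<Sum>k = 1..?N. g k - g (Suc k))"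
    unfolding sum_distrib_left by (intro sum.cong) auto
  also have "\<dots> = 0"
    unfolding sum_telescope_down by (simp add: g_def d_def inv_fact_pair_def)
  finally show ?case
    using step.IH by (subst sum_star_weight_Suc) simp
qed

lemma tstar_part_replicate_2:
  assumes "n \<ge> 1"
  shows "tstar_part n (replicate b 2) = (\<Sum>k = 1..n. star_weight n k * (- ((-1) ^ k) / (2 * real k - 1) ^ (2 * b)))"
proof -
  have "tstar_part n (replicate b 2 @ []) = (\<Sum>k = 1..n. star_weight n k * (- ((-1) ^ k) / (2 * real k - 1) ^ (2 * b)))"
  proof (rule tstar_part_replicate_2_append[OF _ assms])
    show "tstar_part m [] = (\<Sum>k = 1..m. star_weight m k * - ((-1) ^ k))" if "m \<ge> 1" for m
      unfolding alternating_sum_star_weight[OF that] by simp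
  qed
  then show ?thesis by (simp only: append_Nil2)
qed

text \<open>Abel summation with the symmetric combination D(k) + D(k-1): differences of d on one
  side become sums of neighbouring values of d on the other.\<close>

lemma summation_by_parts_midpoint:
  fixes c d D :: "nat \<Rightarrow> real"
  assumes "D 0 = 0" "\<And>k. D (Suc k) = D k + c (Suc k)"
  shows "(\<Sum>k = 1..N. (d k - d (Suc k)) * (D k + D (k - 1))) = (\<Sum>k = 1..N. c k * (d k + d (Suc k))) - 2 * d (Suc N) * D N"
  by (induction N) (auto simp: assms algebra_simps)

text \<open>Summation by parts turns d(k) - d(k+1) into d(k) + d(k+1), which carries a factor
  o(n+1). This cancels one of the two powers of o(n+1) in \<open>sum_star_weight_Suc\<close>, so the
  new outer entry is 1 instead of 2.\<close>

lemma tstar_part_1_replicate_2: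
  "tstar_part n (1 # replicate b 2) =
     (\<Sum>k = 1..n. star_weight n k *
        - (tval_part k [(2 * b + 1, True)] + tval_part (k - 1) [(2 * b + 1, True)]))"
proof (induction n)
  case (Suc n)
  let ?N = "Suc n"
  define D where "D = (\<lambda>k. tval_part k [(2 * b + 1, True)])"
  define c where "c = (\<lambda>k. (-1) ^ k / (2 * real k - 1) ^ (2 * b + 1))"
  define d where "d = inv_fact_pair ?N"
  have w: "star_weight ?N k * (2 * real k - 1)\<^sup>2 = star_weight_const ?N * (d k - d (Suc k))"
    "(2 * real ?N - 1) * (star_weight ?N k * (2 * real k - 1)) = star_weight_const ?N * (d k + d (Suc k))"
    if "k \<in> {1..?N}" for k
  proof -
    define F where "F = (fact (?N - k) * fact (?N + k - 1) :: real)"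
    have F: "F \<noteq> 0" by (simp add: F_def)
    have k: "1 \<le> k" "k \<le> ?N" using that by auto
    note D = inv_fact_pair_eq[OF k, folded d_def F_def]
    have "star_weight ?N k = star_weight_const ?N / ((2 * real k - 1) * F)"
      using k by (simp add: star_weight_def F_def mult.assoc)
    moreover have "d k - d (Suc k) = (2 * real k - 1) / F" "d k + d (Suc k) = (2 * real ?N - 1) / F"
      unfolding D using F by (simp_all add: field_simps)
    ultimately show "star_weight ?N k * (2 * real k - 1)\<^sup>2 = star_weight_const ?N * (d k - d (Suc k))"
      "(2 * real ?N - 1) * (star_weight ?N k * (2 * real k - 1)) = star_weight_const ?N * (d k + d (Suc k))"
      using F odd_real_nonzero[of k] by (simp_all add: power2_eq_square)
  qed
  have "(\<Sum>k = 1..?N. star_weight ?N k * ((2 * real k - 1)\<^sup>2 * - (D k + D (k - 1))))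
      = - star_weight_const ?N * (\<Sum>k = 1..?N. (d k - d (Suc k)) * (D k + D (k - 1)))"
    unfolding sum_distrib_left mult.assoc[symmetric]
    by (rule sum.cong) (auto simp: w simp del: minus_add_distrib)
  also have "\<dots> = - star_weight_const ?N * (\<Sum>k = 1..?N. c k * (d k + d (Suc k)))"
    \<comment> \<open>The boundary term drops out because \<open>d\<close> vanishes at
      \<open>Suc ?N\<close>.\<close>
    by (subst summation_by_parts_midpoint[where c = c]) (auto simp: D_def c_def d_def inv_fact_pair_def)
  also have "\<dots> = (2 * real ?N - 1) * (\<Sum>k = 1..?N. star_weight ?N k * (- ((-1) ^ k) / (2 * real k - 1) ^ (2 * b)))"
  proof -
    have "- star_weight_const ?N * (c k * (d k + d (Suc k)))
      = (2 * real ?N - 1) * (star_weight ?N k * (- ((-1) ^ k) / (2 * real k - 1) ^ (2 * b)))"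
      if "k \<in> {1..?N}" for k
    proof -
      have "- star_weight_const ?N * (c k * (d k + d (Suc k))) =
        - c k * ((2 * real ?N - 1) * (star_weight ?N k * (2 * real k - 1)))"
        unfolding w(2)[OF that] by simp
      also have "\<dots> = (2 * real ?N - 1) * (star_weight ?N k * - (c k * (2 * real k - 1)))"
        by (simp only: mult_ac mult_minus_left mult_minus_right)
      also have "- (c k * (2 * real k - 1)) = - ((-1) ^ k) / (2 * real k - 1) ^ (2 * b)"
        using odd_real_nonzero[of k] by (simp add: c_def)
      finally show ?thesis .
    qed
    then show ?thesis unfolding sum_distrib_left by (intro sum.cong) auto
  qed
  also have "\<dots> = (2 * real ?N - 1) * tstar_part ?N (replicate b 2)"
    by (subst tstar_part_replicate_2) auto
  finally have "(\<Sum>k = 1..?N. star_weight ?N k * ((2 * real k - 1)\<^sup>2 * - (D k + D (k - 1)))) / (2 * real ?N - 1)\<^sup>2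
     = tstar_part ?N (replicate b 2) / (2 * real ?N - 1)"
    using odd_real_nonzero[of ?N] by (simp add: power2_eq_square)
  moreover have "tstar_part ?N (1 # replicate b 2)
      = tstar_part n (1 # replicate b 2) + tstar_part ?N (replicate b 2) / (2 * real ?N - 1)"
    by simp
  ultimately show ?case
    using Suc.IH sum_star_weight_Suc[of n "\<lambda>k. - (D k + D (k - 1))"] unfolding D_def by (simp only:)
qed simp

lemma tstar_part_2_1_2:
  assumes "n \<ge> 1"
  shows "tstar_part n (replicate a 2 @ [1] @ replicate b 2) =
     - (\<Sum>k = 1..n. star_weight n k *
        ((tval_part k [(2 * b + 1, True)] + tval_part (k - 1) [(2 * b + 1, True)]) / (2 * real k - 1) ^ (2 * a)))"
proof -
  have "tstar_part n (replicate a 2 @ 1 # replicate b 2) = (\<Sum>k = 1..n. star_weight n k *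
        (- (tval_part k [(2 * b + 1, True)] + tval_part (k - 1) [(2 * b + 1, True)]) / (2 * real k - 1) ^ (2 * a)))"
    by (rule tstar_part_replicate_2_append[OF tstar_part_1_replicate_2 assms])
  then show ?thesis
    by (simp only: append.simps minus_divide_left[symmetric] mult_minus_right sum_negf)
qed

text \<open>The ratio lies between 0 and 1 and tends to 1 as n grows. Hence w(n,k) o(k) decreases in
  k, and its limit in n is the same for every k.\<close>

lemma star_weight_Suc_right:
  assumes "k \<ge> 1" "n \<ge> k"
  shows "star_weight n (Suc k) * (2 * real (Suc k) - 1) =
    star_weight n k * (2 * real k - 1) * ((real n - real k) / (real n + real k))"
proof -
  obtain j where j: "k = Suc j" using assms by (cases k) auto
  obtain m where m: "n = k + m" using assms le_Suc_ex by blast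
  define F where "F = (fact (Suc (2 * j + m)) :: real)"
  have e: "n - k = m" "n + k - 1 = Suc (2 * j + m)"
    "n + Suc k - 1 = Suc (Suc (2 * j + m))" "real n + real k = 2 * real j + real m + 2"
    "real n - real k = real m"
    using j m by auto
  have f: "fact (Suc (Suc (2 * j + m))) = (2 * real j + real m + 2) * F"
    unfolding F_def by (subst fact_Suc) (simp add: algebra_simps)
  have F: "F \<noteq> 0" by (simp add: F_def)
  have nz: "2 * real j + real m + 2 \<noteq> 0" by linarith
  show ?thesis
  proof (cases m)
    case 0
    then show ?thesis using m by (simp add: star_weight_def)
  next
    case (Suc i)
    then have i: "n - Suc k = i" "Suc k \<le> n" using m by auto
    have g: "(fact m :: real) = real m * fact i" using Suc by simp
    define x where "x = 2 * real k - 1"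
    define y where "y = 2 * real (Suc k) - 1"
    have xy: "x \<noteq> 0" "y \<noteq> 0" unfolding x_def y_def by (rule odd_real_nonzero)+
    show ?thesis
      unfolding star_weight_def e f i g F_def[symmetric] x_def[symmetric] y_def[symmetric]
      using F nz xy i assms Suc by simp
  qed
qed

text \<open>Identifies the first weight, up to an elementary factor tending to 2, as the reciprocal
  of the partial Wallis product; this is the source of pi.\<close>

lemma star_weight_1_wallis:
  assumes "n \<ge> 1"
  shows "star_weight n 1 * (\<Prod>k=1..n. (4 * real k ^ 2) / (4 * real k ^ 2 - 1)) = 4 * real n / (2 * real n + 1)"
  using assms
proof (induction n rule: dec_induct)
  case base
  show ?case by (simp add: star_weight_def star_weight_const_def)
next
  case (step n)
  define P where "P = (\<Prod>k=1..n. (4 * real k ^ 2) / (4 * real k ^ 2 - 1))"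
  obtain m where m: "n = Suc m" using step.hyps by (cases n) auto
  have "star_weight (Suc n) 1 = star_weight n 1 * ((2 * real n + 1)\<^sup>2 / (4 * real n * (real n + 1)))"
    unfolding star_weight_def m by (simp add: star_weight_const_Suc field_simps)
  then have "star_weight (Suc n) 1 * (\<Prod>k=1..Suc n. (4 * real k ^ 2) / (4 * real k ^ 2 - 1)) =
    (star_weight n 1 * P) * ((2 * real n + 1)\<^sup>2 / (4 * real n * (real n + 1))) * (4 * real (Suc n) ^ 2 / (4 * real (Suc n) ^ 2 - 1))"
    by (simp add: P_def)
  also have "4 * real (Suc n) ^ 2 - 1 = (2 * real n + 1) * (2 * real n + 3)"
    by (simp add: power2_eq_square algebra_simps)
  also have "star_weight n 1 * P = 4 * real n / (2 * real n + 1)"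
    using step.IH by (simp add: P_def)
  also have "4 * real n / (2 * real n + 1) * ((2 * real n + 1)\<^sup>2 / (4 * real n * (real n + 1))) * (4 * real (Suc n) ^ 2 / ((2 * real n + 1) * (2 * real n + 3)))
     = 4 * real (Suc n) / (2 * real (Suc n) + 1)"
    using step.hyps by (simp add: divide_simps power2_eq_square add_nonneg_eq_0_iff) (simp add: algebra_simps)
  finally show ?case .
qed

subsection \<open>Passage to the limit\<close>

lemma star_weight_1_tendsto: "(\<lambda>n. star_weight n 1) \<longlonglongrightarrow> 4 / pi"
proof -
  let ?W = "\<lambda>n. \<Prod>k=1..n. (4 * real k ^ 2) / (4 * real k ^ 2 - 1)"
  have "(\<lambda>n. 4 * real n / (2 * real n + 1)) \<longlonglongrightarrow> 2"
    by real_asymp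
  then have "(\<lambda>n. (4 * real n / (2 * real n + 1)) / ?W n) \<longlonglongrightarrow> 2 / (pi / 2)"
    by (intro tendsto_divide wallis) auto
  moreover have "eventually (\<lambda>n. (4 * real n / (2 * real n + 1)) / ?W n = star_weight n 1) at_top"
    using eventually_ge_at_top[of 1]
  proof eventually_elim
    case (elim n)
    define W where "W = ?W n"
    have eq: "star_weight n 1 * W = 4 * real n / (2 * real n + 1)"
      unfolding W_def by (rule star_weight_1_wallis[OF elim])
    moreover from this have "W \<noteq> 0"
      using elim by (auto simp: divide_simps)
    ultimately have "4 * real n / (2 * real n + 1) / W = star_weight n 1"
      by (metis nonzero_mult_div_cancel_right)
    then show ?case unfolding W_def .
  qed
  ultimately show ?thesis
    using Lim_transform_eventually by fastforce
qed

lemma star_weight_tendsto: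
  assumes "k \<ge> 1"
  shows "(\<lambda>n. star_weight n k * (2 * real k - 1)) \<longlonglongrightarrow> 4 / pi"
  using assms
proof (induction k rule: dec_induct)
  case base
  show ?case using star_weight_1_tendsto by simp
next
  case (step k)
  have "(\<lambda>n. (real n - real k) / (real n + real k)) \<longlonglongrightarrow> 1"
    by real_asymp
  from tendsto_mult[OF step.IH this]
  have "(\<lambda>n. star_weight n k * (2 * real k - 1) * ((real n - real k) / (real n + real k))) \<longlonglongrightarrow> 4 / pi"
    by simp
  moreover have "eventually (\<lambda>n. star_weight n k * (2 * real k - 1) * ((real n - real k) / (real n + real k))
      = star_weight n (Suc k) * (2 * real (Suc k) - 1)) at_top"
    using eventually_ge_at_top[of k] by eventually_elim (use star_weight_Suc_right step.hyps in simp)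
  ultimately show ?case
    by (rule Lim_transform_eventually)
qed

lemma star_weight_le_first:
  assumes "k \<ge> 1"
  shows "star_weight n k * (2 * real k - 1) \<le> star_weight n 1"
  using assms
proof (induction k rule: dec_induct)
  case (step k)
  show ?case
  proof (cases "k \<le> n")
    case True
    have "star_weight n k * (2 * real k - 1) * ((real n - real k) / (real n + real k))
      \<le> star_weight n k * (2 * real k - 1) * 1"
      using True step.hyps star_weight_nonneg[of k n]
      by (intro mult_left_mono) auto
    then show ?thesis
      using star_weight_Suc_right[OF step.hyps(1) True] step.IH by simp
  next
    case False
    then show ?thesis using star_weight_nonneg[of 1 n] by (simp add: star_weight_def)
  qed
qed simp

lemma star_weight_bounded:
  obtains K where "\<And>n k. k \<ge> 1 \<Longrightarrow> \<bar>star_weight n k * (2 * real k - 1)\<bar> \<le> K"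
proof -
  have "Bseq (\<lambda>n. star_weight n 1)"
    using star_weight_1_tendsto by (intro convergent_imp_Bseq convergentI)
  then obtain K where K: "\<And>n. \<bar>star_weight n 1\<bar> \<le> K"
    unfolding Bseq_def by auto
  show ?thesis
  proof (rule that)
    fix n k :: nat assume k: "k \<ge> 1"
    have "star_weight n k * (2 * real k - 1) \<ge> 0"
      using k star_weight_nonneg[OF k, of n] by auto
    then show "\<bar>star_weight n k * (2 * real k - 1)\<bar> \<le> K"
      using star_weight_le_first[OF k, of n] K[of n] by linarith
  qed
qed

text \<open>Leibniz' criterion, which covers s = 1 too. The shift k = n + 1 accounts for the minus
  sign in front of the alternating series.\<close>

lemma tval_bar_tendsto:
  assumes "s \<ge> 1"
  shows "(\<lambda>N. tval_part N [(s, True)]) \<longlonglongrightarrow> tval [(s, True)]"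
proof -
  let ?a = "\<lambda>n. 1 / (2 * real n + 1) ^ s"
  have "?a \<longlonglongrightarrow> 0"
  proof (rule tendsto_sandwich[OF always_eventually always_eventually tendsto_const])
    show "(\<lambda>n. 1 / (2 * real n + 1)) \<longlonglongrightarrow> 0" by real_asymp
    show "\<forall>n. ?a n \<le> 1 / (2 * real n + 1)"
      using assms power_increasing[of 1 s "2 * real n + 1" for n]
      by (auto intro!: divide_left_mono)
  qed auto
  moreover have "monoseq ?a"
    unfolding monoseq_def
    by (rule disjI2) (auto intro!: divide_left_mono power_mono)
  ultimately have "summable (\<lambda>n. (-1) ^ n * ?a n)"
    by (rule summable_Leibniz(1))
  then have "(\<lambda>N. - (\<Sum>n<N. (-1) ^ n * ?a n)) \<longlonglongrightarrow> - (\<Sum>n. (-1) ^ n * ?a n)"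
    by (intro tendsto_minus summable_LIMSEQ)
  moreover have "- (\<Sum>n<N. (-1) ^ n * ?a n) = tval_part N [(s, True)]" for N
    by (induction N) (auto simp: add_ac)
  ultimately have "convergent (\<lambda>N. tval_part N [(s, True)])"
    by (auto intro: convergentI)
  then show ?thesis
    by (simp add: convergent_LIMSEQ_iff tval_def)
qed

lemma tval_part_bar_bounded:
  assumes "s \<ge> 1"
  obtains B where "\<And>N. \<bar>tval_part N [(s, True)]\<bar> \<le> B"
proof -
  have "Bseq (\<lambda>N. tval_part N [(s, True)])"
    using tval_bar_tendsto[OF assms] by (intro convergent_imp_Bseq convergentI)
  then show ?thesis
    using that unfolding Bseq_def real_norm_def by metis
qed

section \<open>Dominated convergence for the truncated sums\<close>

lemma summable_odd_power:
  assumes "s \<ge> 2"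
  shows "summable (\<lambda>k. C / (2 * real (Suc k) - 1) ^ s)"
proof -
  have "summable (\<lambda>k. inverse (real (Suc k) ^ s))"
    using inverse_power_summable[OF assms, where ?'a = real] by (subst summable_Suc_iff) 
  then have "summable (\<lambda>k. 1 / (2 * real (Suc k) - 1) ^ s)"
  proof (rule summable_comparison_test')
    fix k
    show "norm (1 / (2 * real (Suc k) - 1) ^ s) \<le> inverse (real (Suc k) ^ s)"
      by (simp add: divide_simps power_mono)
  qed
  from summable_mult[OF this, of C] show ?thesis by simp
qed

lemma tannery_sequence:
  fixes f :: "nat \<Rightarrow> nat \<Rightarrow> real"
  assumes "\<And>k. (\<lambda>n. f k n) \<longlonglongrightarrow> g k" "\<And>k n. \<bar>f k n\<bar> \<le> M k" "summable M"
  shows "(\<lambda>n. \<Sum>k. f k n) \<longlonglongrightarrow> suminf g"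
proof -
  have "eventually (\<lambda>(k, n). norm (f k n) \<le> M k) (sequentially \<times>\<^sub>F sequentially)"
    using assms(2) by (intro always_eventually) auto
  from tannerys_theorem[OF assms(1) this assms(3)]
  show ?thesis by simp
qed

text \<open>For s = 2b + 1 this is V(k), by the symmetry of c under l to 1 - l.\<close>

definition mid_sum :: "nat \<Rightarrow> nat \<Rightarrow> real" where
  "mid_sum s k = tval_part k [(s, True)] + tval_part (k - 1) [(s, True)]"

definition mid_series :: "nat \<Rightarrow> nat \<Rightarrow> real" where
  "mid_series t s = (\<Sum>k. mid_sum s (Suc k) / (2 * real (Suc k) - 1) ^ t)"

lemma mid_sum_bounded:
  assumes "s \<ge> 1"
  obtains B where "\<And>k. \<bar>mid_sum s k\<bar> \<le> B"
proof -
  obtain B where B: "\<And>N. \<bar>tval_part N [(s, True)]\<bar> \<le> B"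
    using tval_part_bar_bounded[OF assms] by blast
  show ?thesis
  proof (rule that)
    show "\<bar>mid_sum s k\<bar> \<le> 2 * B" for k
      unfolding mid_sum_def using B[of k] B[of "k - 1"] by linarith
  qed
qed

lemma summable_mid_series:
  assumes "s \<ge> 1" "t \<ge> 2"
  shows "summable (\<lambda>k. mid_sum s (Suc k) / (2 * real (Suc k) - 1) ^ t)"
proof -
  obtain B where B: "\<And>k. \<bar>mid_sum s k\<bar> \<le> B"
    using mid_sum_bounded[OF assms(1)] by blast
  show ?thesis
  proof (rule summable_comparison_test')
    show "summable (\<lambda>k. B / (2 * real (Suc k) - 1) ^ t)"
      by (rule summable_odd_power[OF assms(2)])
    show "norm (mid_sum s (Suc k) / (2 * real (Suc k) - 1) ^ t) \<le> B / (2 * real (Suc k) - 1) ^ t" for k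
      using B[of "Suc k"] by (simp add: abs_div divide_right_mono)
  qed
qed

lemma tstar_eq_mid_series:
  assumes "a \<ge> 1"
  shows "tstar (replicate a 2 @ [1] @ replicate b 2) = - 4 / pi * mid_series (2 * a + 1) (2 * b + 1)"
proof -
  define V where "V = mid_sum (2 * b + 1)"
  define f where "f = (\<lambda>k n. star_weight n (Suc k) * (V (Suc k) / (2 * real (Suc k) - 1) ^ (2 * a)))"
  define g where "g = (\<lambda>k. 4 / pi * (V (Suc k) / (2 * real (Suc k) - 1) ^ (2 * a + 1)))"
  \<comment> \<open>One factor o(k) goes to the weight, which makes it uniformly bounded and
    convergent; the exponent 2a + 1 \<ge> 3 left in the denominator gives a summable
    majorant.\<close>
  have f_eq: "f k n = star_weight n (Suc k) * (2 * real (Suc k) - 1) * (V (Suc k) / (2 * real (Suc k) - 1) ^ (2 * a + 1))" for k n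
    using odd_real_nonzero[of "Suc k"] by (simp add: f_def)
  obtain B where B: "\<And>k. \<bar>V k\<bar> \<le> B"
    using mid_sum_bounded[of "2 * b + 1"] unfolding V_def by auto
  obtain K where K: "\<And>n k. k \<ge> 1 \<Longrightarrow> \<bar>star_weight n k * (2 * real k - 1)\<bar> \<le> K"
    using star_weight_bounded by blast
  have "(\<lambda>n. \<Sum>k. f k n) \<longlonglongrightarrow> suminf g"
  proof (rule tannery_sequence)
    show "(\<lambda>n. f k n) \<longlonglongrightarrow> g k" for k
      unfolding f_eq g_def by (intro tendsto_mult star_weight_tendsto tendsto_const) auto
    show "\<bar>f k n\<bar> \<le> K * B / (2 * real (Suc k) - 1) ^ (2 * a + 1)" for k n
    proof -
      have "\<bar>f k n\<bar> = \<bar>star_weight n (Suc k) * (2 * real (Suc k) - 1)\<bar> * \<bar>V (Suc k)\<bar> / (2 * real (Suc k) - 1) ^ (2 * a + 1)"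
        unfolding f_eq abs_mult abs_divide by (simp add: power_abs)
      also have "\<dots> \<le> K * B / (2 * real (Suc k) - 1) ^ (2 * a + 1)"
        using B[of "Suc k"] K[of "Suc k" n] by (intro divide_right_mono mult_mono) auto
      finally show ?thesis .
    qed
    show "summable (\<lambda>k. K * B / (2 * real (Suc k) - 1) ^ (2 * a + 1))"
      using assms by (intro summable_odd_power) auto
  qed
  moreover have "eventually (\<lambda>n. (\<Sum>k. f k n) = - tstar_part n (replicate a 2 @ [1] @ replicate b 2)) at_top"
    using eventually_ge_at_top[of 1]
  proof eventually_elim
    case (elim n)
    have "(\<Sum>k. f k n) = (\<Sum>k<n. f k n)"
      by (rule suminf_finite) (auto simp: f_def star_weight_def)
    also have "\<dots> = - tstar_part n (replicate a 2 @ [1] @ replicate b 2)"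
      unfolding tstar_part_2_1_2[OF elim] f_def V_def mid_sum_def
      by (simp add: sum.atLeast1_atMost_eq del: tval_part.simps)
    finally show ?case .
  qed
  ultimately have "(\<lambda>n. - tstar_part n (replicate a 2 @ [1] @ replicate b 2)) \<longlonglongrightarrow> suminf g"
    by (rule Lim_transform_eventually)
  then have "(\<lambda>n. tstar_part n (replicate a 2 @ [1] @ replicate b 2)) \<longlonglongrightarrow> - suminf g"
    using tendsto_minus by fastforce
  then have "tstar (replicate a 2 @ [1] @ replicate b 2) = - suminf g"
    unfolding tstar_def by (rule limI)
  also have "suminf g = 4 / pi * mid_series (2 * a + 1) (2 * b + 1)"
    unfolding g_def mid_series_def V_def
    using assms by (intro suminf_mult summable_mid_series) auto
  finally show ?thesis by simp
qed

text \<open>V(k) is twice the sum up to k - 1 plus the diagonal term c(k), giving depth two and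
  depth one respectively. Convergence of the depth-two value is obtained by solving this relation
  for it.\<close>

lemma mid_series_eq_tval:
  assumes "s \<ge> 1" "t \<ge> 2"
  shows "mid_series t s = tval [(t + s, True)] + 2 * tval [(t, False), (s, True)]"
proof -
  have "(\<lambda>N. \<Sum>k<N. mid_sum s (Suc k) / (2 * real (Suc k) - 1) ^ t) \<longlonglongrightarrow> mid_series t s"
    unfolding mid_series_def by (rule summable_LIMSEQ[OF summable_mid_series[OF assms]])
  moreover have eq: "(\<Sum>k<N. mid_sum s (Suc k) / (2 * real (Suc k) - 1) ^ t)
      = tval_part N [(t + s, True)] + 2 * tval_part N [(t, False), (s, True)]" for N
    by (induction N) (auto simp: mid_sum_def field_simps power_add)
  ultimately have "(\<lambda>N. (tval_part N [(t + s, True)] + 2 * tval_part N [(t, False), (s, True)] - tval_part N [(t + s, True)]) / 2)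
      \<longlonglongrightarrow> (mid_series t s - tval [(t + s, True)]) / 2"
    using assms by (intro tendsto_divide tendsto_diff tval_bar_tendsto tendsto_const) auto
  then have "(\<lambda>N. tval_part N [(t, False), (s, True)]) \<longlonglongrightarrow> (mid_series t s - tval [(t + s, True)]) / 2"
    by (simp del: tval_part.simps)
  then have "tval [(t, False), (s, True)] = (mid_series t s - tval [(t + s, True)]) / 2"
    unfolding tval_def[of "[(t, False), (s, True)]"] by (rule limI)
  then show ?thesis by simp
qed

subsection \<open>Bilateral sums\<close>

definition bar_coeff :: "nat \<Rightarrow> int \<Rightarrow> real" where
  "bar_coeff s l = (if even l then 1 else -1) / (2 * of_int l - 1) ^ s"

text \<open>
  The antidifference of \<^const>\<open>bar_coeff\<close> that vanishes at 0; the reflection l to 1 - l dictates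
  its values at negative arguments.
\<close>

definition bar_sum :: "nat \<Rightarrow> int \<Rightarrow> real" where
  "bar_sum s j = (if j \<ge> 0 then tval_part (nat j) [(s, True)] else (-1) ^ s * tval_part (nat (- j)) [(s, True)])"

text \<open>The map l to 1 - l flips both the parity of l and the sign of 2l - 1; for odd s the two
  effects cancel.\<close>

lemma bar_coeff_reflect: "bar_coeff s (1 - l) = - ((-1) ^ s) * bar_coeff s l"
proof -
  have "2 * of_int (1 - l) - 1 = - 1 * (2 * of_int l - 1 :: real)" by simp
  then have "(2 * of_int (1 - l) - 1) ^ s = (-1) ^ s * (2 * of_int l - 1 :: real) ^ s"
    by (simp only: power_mult_distrib)
  then show ?thesis
    unfolding bar_coeff_def by (cases "even s") (auto simp: divide_simps)
qed

lemma bar_sum_minus: "bar_sum s (- j) = (-1) ^ s * bar_sum s j"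
proof (cases "j = 0")
  case True
  then show ?thesis by (simp add: bar_sum_def)
next
  case False
  then show ?thesis by (auto simp: bar_sum_def simp del: tval_part.simps)
qed

text \<open>Positive j is the recursion of the truncated sum; the remaining j are reduced to it by
  reflection.\<close>

lemma bar_sum_diff: "bar_sum s j - bar_sum s (j - 1) = bar_coeff s j"
proof -
  have pos: "bar_sum s j - bar_sum s (j - 1) = bar_coeff s j" if "j \<ge> 1" for j
  proof -
    define n where "n = nat (j - 1)"
    have j: "j = int n + 1" using that by (simp add: n_def)
    have "bar_sum s j = tval_part (Suc n) [(s, True)]" "bar_sum s (j - 1) = tval_part n [(s, True)]"
      unfolding j by (simp_all add: bar_sum_def nat_add_distrib del: tval_part.simps)
    then have "bar_sum s j - bar_sum s (j - 1) = (-1) ^ Suc n / (2 * real (Suc n) - 1) ^ s"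
      by simp
    also have "2 * real (Suc n) - 1 = 2 * real_of_int j - 1" by (simp add: j)
    also have "(-1) ^ Suc n = (if even j then 1 else -1 :: real)" by (simp add: j)
    finally show ?thesis by (simp add: bar_coeff_def)
  qed
  show ?thesis
  proof (cases "j \<ge> 1")
    case True
    then show ?thesis by (rule pos)
  next
    case False
    have "bar_sum s (1 - j) - bar_sum s (- j) = bar_coeff s (1 - j)"
      using pos[of "1 - j"] False by simp
    moreover have "bar_sum s (j - 1) = (-1) ^ s * bar_sum s (1 - j)"
      using bar_sum_minus[of s "1 - j"] by simp
    moreover have "(-1) ^ s * (-1) ^ s = (1 :: real)"
      by (simp add: power_add[symmetric])
    ultimately show ?thesis
      unfolding bar_sum_minus bar_coeff_reflect
      by (cases "even s") auto
  qed
qed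

lemma bar_sum_tendsto:
  assumes "s \<ge> 1"
  shows "(\<lambda>n. bar_sum s (int n + q)) \<longlonglongrightarrow> tval [(s, True)]"
proof -
  have "filterlim (\<lambda>n. nat (int n + q)) at_top at_top"
    unfolding filterlim_at_top
  proof
    fix Z
    show "eventually (\<lambda>n. Z \<le> nat (int n + q)) at_top"
      using eventually_ge_at_top[of "Z + nat (- q)"] by eventually_elim linarith
  qed
  from filterlim_compose[OF tval_bar_tendsto[OF assms] this]
  have "(\<lambda>n. tval_part (nat (int n + q)) [(s, True)]) \<longlonglongrightarrow> tval [(s, True)]" .
  moreover have "eventually (\<lambda>n. tval_part (nat (int n + q)) [(s, True)] = bar_sum s (int n + q)) at_top"
    using eventually_ge_at_top[of "nat (- q)"]
    by eventually_elim (auto simp: bar_sum_def)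
  ultimately show ?thesis by (rule Lim_transform_eventually)
qed

lemma bar_sum_bounded:
  assumes "s \<ge> 1"
  obtains B where "\<And>j. \<bar>bar_sum s j\<bar> \<le> B"
proof -
  obtain B where "\<And>N. \<bar>tval_part N [(s, True)]\<bar> \<le> B"
    using tval_part_bar_bounded[OF assms] by blast
  then have "\<bar>bar_sum s j\<bar> \<le> B" for j
    by (auto simp: bar_sum_def abs_mult power_abs simp del: tval_part.simps)
  then show ?thesis by (rule that)
qed

lemma mid_sum_eq_bar_sum:
  "k \<ge> 1 \<Longrightarrow> mid_sum s k = bar_sum s (int k) + bar_sum s (int k - 1)"
  by (simp add: mid_sum_def bar_sum_def nat_diff_distrib' del: tval_part.simps)

text \<open>A sum over all integers, taken symmetrically by pairing k with 1 - k. It telescopes to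
  the difference of the limits of \<open>bar_sum\<close> at the two ends, so it does not depend on
  the shift p and vanishes for even s.\<close>

lemma bar_coeff_symmetric_sums:
  assumes "s \<ge> 1"
  shows "(\<lambda>k. bar_coeff s (int (Suc k) - p) + bar_coeff s (1 - int (Suc k) - p))
           sums ((1 - (-1) ^ s) * tval [(s, True)])"
proof -
  have "(\<Sum>k<M. bar_coeff s (int (Suc k) - p) + bar_coeff s (1 - int (Suc k) - p))
     = bar_sum s (int M - p) - bar_sum s (- int M - p)" for M
  proof (induction M)
    case (Suc M)
    have "int (Suc M) - p - 1 = int M - p" "1 - int (Suc M) - p = - int M - p"
      "- int M - p - 1 = - int (Suc M) - p" by simp_all
    then show ?case
      unfolding sum.lessThan_Suc Suc
      using bar_sum_diff[of s "int (Suc M) - p"] bar_sum_diff[of s "1 - int (Suc M) - p"]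
      by (simp only:)
  qed simp
  moreover have "bar_sum s (- int M - p) = (-1) ^ s * bar_sum s (int M + p)" for M
    using bar_sum_minus[of s "int M + p"] by simp
  ultimately have eq: "(\<Sum>k<M. bar_coeff s (int (Suc k) - p) + bar_coeff s (1 - int (Suc k) - p))
     = bar_sum s (int M + - p) - (-1) ^ s * bar_sum s (int M + p)" for M
    by simp
  have "(\<lambda>M. bar_sum s (int M + - p) - (-1) ^ s * bar_sum s (int M + p)) \<longlonglongrightarrow>
      tval [(s, True)] - (-1) ^ s * tval [(s, True)]"
    by (intro tendsto_intros bar_sum_tendsto assms)
  then show ?thesis
    unfolding sums_def eq by (simp add: left_diff_distrib)
qed

subsection \<open>Partial fractions\<close>

text \<open>
  The principal part at u = \<infinity> of u^(t+1) v^(s+1), up to sign, where u and v are reciprocals of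
  linear forms differing by 1/w.
\<close>

definition pole_part :: "real \<Rightarrow> real \<Rightarrow> nat \<Rightarrow> nat \<Rightarrow> real" where
  "pole_part w u t s = (\<Sum>i\<le>t + s. w ^ (i + 1) * real (i choose s) * u ^ (t + s - i + 1))"

lemma pole_part_0_left: "pole_part w u 0 s = w ^ (s + 1) * u"
proof -
  have "pole_part w u 0 s = (\<Sum>i\<in>{s}. w ^ (i + 1) * real (i choose s) * u ^ (0 + s - i + 1))"
    unfolding pole_part_def by (rule sum.mono_neutral_right) auto
  then show ?thesis by simp
qed

lemma pole_part_Suc_0: "pole_part w u (Suc t) 0 = w * u ^ (t + 2) + w * pole_part w u t 0"
proof -
  have "pole_part w u (Suc t) 0 = (\<Sum>i\<le>Suc t. w ^ (i + 1) * u ^ (Suc t - i + 1))"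
    by (simp add: pole_part_def del: sum.atMost_Suc)
  also have "\<dots> = w * u ^ (t + 2) + (\<Sum>i\<le>t. w * (w ^ (i + 1) * u ^ (t - i + 1)))"
    by (subst sum.atMost_Suc_shift) (simp add: mult.assoc)
  also have "\<dots> = w * u ^ (t + 2) + w * pole_part w u t 0"
    by (simp add: pole_part_def sum_distrib_left)
  finally show ?thesis .
qed

text \<open>Pascal's rule after an index shift; the term i = 0 is lost because its binomial
  coefficient is 0.\<close>

lemma pole_part_Suc_Suc:
  "pole_part w u (Suc t) (Suc s) = w * (pole_part w u (Suc t) s + pole_part w u t (Suc s))"
proof -
  have "pole_part w u (Suc t) (Suc s) =
      (\<Sum>i\<le>Suc (Suc (t + s)). w ^ (i + 1) * real (i choose Suc s) * u ^ (Suc (Suc (t + s)) - i + 1))"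
    by (simp add: pole_part_def del: sum.atMost_Suc)
  also have "\<dots> = (\<Sum>i\<le>Suc (t + s). w ^ (i + 2) * real (Suc i choose Suc s) * u ^ (Suc (t + s) - i + 1))"
    by (subst sum.atMost_Suc_shift) simp
  also have "\<dots> = w * (pole_part w u (Suc t) s + pole_part w u t (Suc s))"
  proof -
    have 1: "pole_part w u (Suc t) s =
        (\<Sum>i\<le>Suc (t + s). w ^ (i + 1) * real (i choose s) * u ^ (Suc (t + s) - i + 1))"
      by (simp add: pole_part_def del: sum.atMost_Suc)
    have 2: "pole_part w u t (Suc s) =
        (\<Sum>i\<le>Suc (t + s). w ^ (i + 1) * real (i choose Suc s) * u ^ (Suc (t + s) - i + 1))"
      by (simp add: pole_part_def del: sum.atMost_Suc)
    show ?thesis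
      unfolding 1 2 distrib_left sum_distrib_left sum.distrib[symmetric]
      by (rule sum.cong) (simp_all add: algebra_simps)
  qed
  finally show ?thesis .
qed

text \<open>The relation lowers one of the two exponents at a time, and both
  \<open>pole_part\<close> terms obey the same recursion once signs are included. The double
  induction therefore needs no division.\<close>

lemma partial_fractions_two_poles:
  assumes "u * v = w * (v - u)"
  shows "u ^ (t + 1) * v ^ (s + 1) =
    (-1) ^ (s + 1) * pole_part w u t s + (-1) ^ (t + 1) * pole_part (- w) v s t"
proof (induction t arbitrary: s)
  case 0
  show ?case
  proof (induction s)
    case 0
    show ?case using assms by (simp add: pole_part_def algebra_simps)
  next
    case (Suc s)
    have "u ^ (0 + 1) * v ^ (Suc s + 1) = (u * v) * v ^ (s + 1)" by simp
    also have "\<dots> = w * v ^ (s + 2) - w * (u ^ (0 + 1) * v ^ (s + 1))"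
      unfolding assms by (simp add: algebra_simps)
    finally show ?case
      unfolding Suc by (simp add: pole_part_0_left pole_part_Suc_0 algebra_simps)
  qed
next
  case (Suc t)
  note IH = Suc.IH
  show ?case
  proof (induction s)
    case 0
    have "u ^ (Suc t + 1) * v ^ (0 + 1) = (u * v) * u ^ (t + 1)" by simp
    also have "\<dots> = w * (u ^ (t + 1) * v ^ (0 + 1)) - w * u ^ (t + 2)"
      unfolding assms by (simp add: algebra_simps)
    finally show ?case
      unfolding IH by (simp add: pole_part_0_left pole_part_Suc_0 algebra_simps)
  next
    case (Suc s)
    have "u ^ (Suc t + 1) * v ^ (Suc s + 1) = (u * v) * (u ^ (t + 1) * v ^ (s + 1))" by simp
    also have "\<dots> = w * (u ^ (t + 1) * v ^ (Suc s + 1)) - w * (u ^ (Suc t + 1) * v ^ (s + 1))"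
      unfolding assms by (simp add: algebra_simps)
    finally show ?case
      unfolding IH Suc pole_part_Suc_Suc by (simp add: algebra_simps)
  qed
qed

lemma sum_atMost_double:
  fixes h :: "nat \<Rightarrow> real"
  assumes "\<And>i. odd i \<Longrightarrow> h i = 0"
  shows "(\<Sum>i\<le>2 * M. h i) = (\<Sum>r\<le>M. h (2 * r))"
  by (induction M) (auto simp: assms)

lemma odd_int_real_nonzero: "2 * real_of_int k - 1 \<noteq> 0"
proof
  assume "2 * real_of_int k - 1 = 0"
  then have "real_of_int (2 * k) = real_of_int 1" by simp
  then have "2 * k = 1" by (simp only: of_int_eq_iff)
  then show False by presburger
qed

text \<open>Taken with u = 1/x, v = 1/y and w = 1/(2p), where x - y = 2p. The factor (-1)^p compares
  the parities of k and k - p, and (-1)^i comes from the powers of -w.\<close>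

lemma bar_coeff_partial_fractions:
  assumes "p \<ge> 1"
  shows "bar_coeff (2 * b + 1) (k - int p) / (2 * of_int k - 1) ^ (2 * a + 1) =
    (\<Sum>i\<le>2 * (a + b). (1 / (2 * real p)) ^ (i + 1) *
       ((-1) ^ i * real (i choose (2 * a)) * bar_coeff (2 * (a + b) - i + 1) (k - int p)
        - (-1) ^ p * real (i choose (2 * b)) * bar_coeff (2 * (a + b) - i + 1) k))"
proof -
  define x where "x = 2 * real_of_int k - 1"
  define y where "y = 2 * real_of_int (k - int p) - 1"
  define \<epsilon> :: real where "\<epsilon> = (if even (k - int p) then 1 else -1)"
  define w where "w = 1 / (2 * real p)"
  have xy: "x \<noteq> 0" "y \<noteq> 0" unfolding x_def y_def by (rule odd_int_real_nonzero)+
  have "y = x - 2 * real p" by (simp add: x_def y_def)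
  then have rel: "(1 / x) * (1 / y) = w * (1 / y - 1 / x)"
    using xy assms by (simp add: w_def field_simps)
  have y: "bar_coeff j (k - int p) = \<epsilon> * (1 / y) ^ j" for j
    by (simp add: bar_coeff_def \<epsilon>_def y_def power_one_over)
  have "(if even k then 1 else -1) = (-1) ^ p * \<epsilon>"
    by (auto simp: \<epsilon>_def)
  then have x: "bar_coeff j k = (-1) ^ p * \<epsilon> * (1 / x) ^ j" for j
    unfolding bar_coeff_def x_def[symmetric] by (simp add: power_one_over)
  have pp: "(-1) ^ p * ((-1) ^ p * z) = (z :: real)" for z
    by (cases "even p") auto
  have sgn: "(- w) ^ (i + 1) = - ((-1) ^ i) * w ^ (i + 1)" for i
    by (subst power_minus) simp
  have "bar_coeff (2 * b + 1) (k - int p) / x ^ (2 * a + 1) = \<epsilon> * ((1 / x) ^ (2 * a + 1) * (1 / y) ^ (2 * b + 1))"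
    unfolding y by (simp add: power_one_over)
  also have "\<dots> = \<epsilon> * (pole_part (- w) (1 / y) (2 * b) (2 * a) * (-1) - pole_part w (1 / x) (2 * a) (2 * b))"
    unfolding partial_fractions_two_poles[OF rel] by simp
  also have "pole_part (- w) (1 / y) (2 * b) (2 * a) * (-1)
      = (\<Sum>i\<le>2 * (a + b). w ^ (i + 1) * ((-1) ^ i * real (i choose (2 * a)) * (1 / y) ^ (2 * (a + b) - i + 1)))"
    unfolding pole_part_def sgn sum_distrib_right by (rule sum.cong) (auto simp: algebra_simps)
  also have "pole_part w (1 / x) (2 * a) (2 * b)
      = (\<Sum>i\<le>2 * (a + b). w ^ (i + 1) * (real (i choose (2 * b)) * (1 / x) ^ (2 * (a + b) - i + 1)))"
    unfolding pole_part_def by (rule sum.cong) (auto simp: algebra_simps)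
  also have "\<epsilon> * ((\<Sum>i\<le>2 * (a + b). w ^ (i + 1) * ((-1) ^ i * real (i choose (2 * a)) * (1 / y) ^ (2 * (a + b) - i + 1)))
      - (\<Sum>i\<le>2 * (a + b). w ^ (i + 1) * (real (i choose (2 * b)) * (1 / x) ^ (2 * (a + b) - i + 1))))
    = (\<Sum>i\<le>2 * (a + b). w ^ (i + 1) *
       ((-1) ^ i * real (i choose (2 * a)) * bar_coeff (2 * (a + b) - i + 1) (k - int p)
        - (-1) ^ p * real (i choose (2 * b)) * bar_coeff (2 * (a + b) - i + 1) k))"
    unfolding sum_subtractf[symmetric] sum_distrib_left
  proof (rule sum.cong, goal_cases)
    case (2 i)
    define X where "X = (1 / x) ^ (2 * (a + b) - i + 1)"
    define Y where "Y = (1 / y) ^ (2 * (a + b) - i + 1)"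
    show ?case
      unfolding x y X_def[symmetric] Y_def[symmetric]
      using pp[of "real (i choose (2 * b)) * \<epsilon> * X"] by (simp add: algebra_simps)
  qed simp
  finally show ?thesis unfolding x_def w_def .
qed

subsection \<open>Evaluation by zeta values\<close>

text \<open>The value of the sum over all integers k of c(k - p) / o(k)^(2a+1). Only even i = 2r
  survive from the partial fractions, and the factor 2 is 1 - (-1)^j for odd j.\<close>

definition shift_series :: "nat \<Rightarrow> nat \<Rightarrow> nat \<Rightarrow> real" where
  "shift_series a b p = (\<Sum>r\<le>a + b. (1 / (2 * real p)) ^ (2 * r + 1) *
     (real ((2 * r) choose (2 * a)) - (-1) ^ p * real ((2 * r) choose (2 * b))) *
     (2 * tval [(2 * a + 2 * b + 1 - 2 * r, True)]))"

lemma shift_series_sums: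
  assumes "p \<ge> 1"
  shows "(\<lambda>k. (bar_coeff (2 * b + 1) (int (Suc k) - int p) - bar_coeff (2 * b + 1) (int (Suc k) + int p))
             / (2 * real (Suc k) - 1) ^ (2 * a + 1)) sums shift_series a b p"
proof -
  define N where "N = 2 * (a + b)"
  define w where "w = 1 / (2 * real p)"
  define A where "A = (\<lambda>i. (-1) ^ i * real (i choose (2 * a)))"
  define B where "B = (\<lambda>i. (-1) ^ p * real (i choose (2 * b)))"
  define g where "g = (\<lambda>k. bar_coeff (2 * b + 1) (k - int p) / (2 * of_int k - 1) ^ (2 * a + 1))"
  define S where "S = (\<lambda>q s k. bar_coeff s (int (Suc k) - q) + bar_coeff s (1 - int (Suc k) - q))"
  \<comment> \<open>Pairs k with 1 - k: the numerator becomes c(k + p) by reflection, while the odd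
    power of o(1 - k) supplies the minus sign.\<close>
  have term_eq: "(bar_coeff (2 * b + 1) (int (Suc k) - int p) - bar_coeff (2 * b + 1) (int (Suc k) + int p))
             / (2 * real (Suc k) - 1) ^ (2 * a + 1) = g (int (Suc k)) + g (1 - int (Suc k))" for k
  proof -
    have "bar_coeff (2 * b + 1) (1 - int (Suc k) - int p) = bar_coeff (2 * b + 1) (int (Suc k) + int p)"
      using bar_coeff_reflect[of "2 * b + 1" "int (Suc k) + int p"] by (simp add: algebra_simps)
    moreover have "2 * real_of_int (1 - int (Suc k)) - 1 = - (2 * real (Suc k) - 1)" by simp
    then have "(2 * real_of_int (1 - int (Suc k)) - 1) ^ (2 * a + 1) = - ((2 * real (Suc k) - 1) ^ (2 * a + 1))"
      by (simp only:) (rule power_minus_odd, simp)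
    ultimately show ?thesis
      unfolding g_def by (simp only: of_int_of_nat_eq divide_minus_right diff_divide_distrib)
  qed
  have g_eq: "g k = (\<Sum>i\<le>N. w ^ (i + 1) * (A i * bar_coeff (N - i + 1) (k - int p) - B i * bar_coeff (N - i + 1) k))" for k
    unfolding g_def bar_coeff_partial_fractions[OF assms] A_def B_def w_def N_def by simp
  have "g (int (Suc k)) + g (1 - int (Suc k)) = (\<Sum>i\<le>N. w ^ (i + 1) * (A i * S (int p) (N - i + 1) k - B i * S 0 (N - i + 1) k))" for k
    unfolding g_eq S_def sum.distrib[symmetric] by (rule sum.cong) (simp_all add: algebra_simps)
  then have "(\<lambda>k. g (int (Suc k)) + g (1 - int (Suc k))) sums
     (\<Sum>i\<le>N. w ^ (i + 1) * (A i * ((1 - (-1) ^ (N - i + 1)) * tval [(N - i + 1, True)])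
        - B i * ((1 - (-1) ^ (N - i + 1)) * tval [(N - i + 1, True)])))"
    unfolding S_def by (simp only:) (intro sums_sum sums_mult sums_diff bar_coeff_symmetric_sums; simp)
  also have "(\<Sum>i\<le>N. w ^ (i + 1) * (A i * ((1 - (-1) ^ (N - i + 1)) * tval [(N - i + 1, True)])
        - B i * ((1 - (-1) ^ (N - i + 1)) * tval [(N - i + 1, True)]))) =
     (\<Sum>i\<le>2 * (a + b). if odd i then 0 else w ^ (i + 1) * (A i - B i) * (2 * tval [(N - i + 1, True)]))"
    unfolding N_def by (rule sum.cong) (auto simp: algebra_simps)
  also have "\<dots> = shift_series a b p"
    unfolding shift_series_def
    by (subst sum_atMost_double)
      (auto intro!: sum.cong simp: A_def B_def w_def N_def Suc_diff_le algebra_simps)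
  finally show ?thesis unfolding term_eq .
qed

text \<open>Summing over p \<le> P first telescopes for each fixed k to V(k) plus a remainder that
  tends to 0. All these sums are bounded by 4B, so 4B / o(k)^(2a+1) dominates and the order of
  summation may be exchanged.\<close>

lemma shift_series_sums_mid_series:
  assumes "a \<ge> 1"
  shows "(\<lambda>q. shift_series a b (Suc q)) sums mid_series (2 * a + 1) (2 * b + 1)"
proof -
  define s where "s = 2 * b + 1"
  have s: "s \<ge> 1" by (simp add: s_def)
  define den where "den = (\<lambda>k. (2 * real (Suc k) - 1) ^ (2 * a + 1))"
  have den_pos: "den k > 0" for k by (simp add: den_def)
  define h where "h = (\<lambda>p k. bar_coeff s (int (Suc k) - int p) - bar_coeff s (int (Suc k) + int p))"
  define f where "f = (\<lambda>k P. (\<Sum>q<P. h (Suc q) k) / den k)"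
  obtain B where B: "\<And>j. \<bar>bar_sum s j\<bar> \<le> B"
    using bar_sum_bounded[OF s] by blast
  have h_sum: "(\<Sum>q<P. h (Suc q) k) = bar_sum s (int (Suc k)) + bar_sum s (int (Suc k) - 1)
      + bar_sum s (int P + (1 - int (Suc k))) - bar_sum s (int P + int (Suc k))" for P k
  proof -
    have "(\<Sum>q<P. h (Suc q) k) = bar_sum s (int (Suc k)) + bar_sum s (int (Suc k) - 1)
      - bar_sum s (int (Suc k) - int P - 1) - bar_sum s (int P + int (Suc k))"
    proof (induction P)
      case (Suc P)
      have "int (Suc k) - int P - 1 = int (Suc k) - int (Suc P)"
        "int (Suc k) + int (Suc P) = int (Suc P) + int (Suc k)"
        "int (Suc P) + int (Suc k) - 1 = int P + int (Suc k)" by simp_all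
      moreover have "h (Suc P) k = bar_coeff s (int (Suc k) - int (Suc P)) - bar_coeff s (int (Suc k) + int (Suc P))"
        by (simp only: h_def)
      ultimately show ?case
        unfolding sum.lessThan_Suc Suc
        using bar_sum_diff[of s "int (Suc k) - int (Suc P)"] bar_sum_diff[of s "int (Suc k) + int (Suc P)"]
        by (simp only:)
    qed simp
    \<comment> \<open>As s is odd, the far negative end contributes with the sign that cancels the
      far positive end in the limit.\<close>
    moreover have "bar_sum s (int (Suc k) - int P - 1) = - bar_sum s (int P + (1 - int (Suc k)))"
      using bar_sum_minus[of s "int P + (1 - int (Suc k))"] by (simp add: s_def algebra_simps)
    ultimately show ?thesis by simp
  qed
  have "(\<lambda>P. \<Sum>k. f k P) \<longlonglongrightarrow> (\<Sum>k. mid_sum s (Suc k) / den k)"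
  proof (rule tannery_sequence)
    fix k
    have "(\<lambda>P. (\<Sum>q<P. h (Suc q) k)) \<longlonglongrightarrow> bar_sum s (int (Suc k)) + bar_sum s (int (Suc k) - 1)
      + tval [(s, True)] - tval [(s, True)]"
      unfolding h_sum by (intro tendsto_intros bar_sum_tendsto s)
    then have "(\<lambda>P. (\<Sum>q<P. h (Suc q) k)) \<longlonglongrightarrow> mid_sum s (Suc k)"
      by (simp add: mid_sum_eq_bar_sum)
    then show "(\<lambda>P. f k P) \<longlonglongrightarrow> mid_sum s (Suc k) / den k"
      unfolding f_def by (intro tendsto_divide tendsto_const) (use den_pos[of k] in auto)
    fix P
    have "\<bar>\<Sum>q<P. h (Suc q) k\<bar> \<le> 4 * B"
      unfolding h_sum
      using B[of "int (Suc k)"] B[of "int (Suc k) - 1"] B[of "int P + (1 - int (Suc k))"]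
        B[of "int P + int (Suc k)"] by linarith
    then show "\<bar>f k P\<bar> \<le> 4 * B / den k"
      unfolding f_def abs_divide using den_pos[of k] by (simp add: divide_right_mono)
  next
    show "summable (\<lambda>k. 4 * B / den k)"
      unfolding den_def using assms by (intro summable_odd_power) auto
  qed
  moreover have "(\<Sum>k. f k P) = (\<Sum>q<P. shift_series a b (Suc q))" for P
  proof -
    have "(\<lambda>k. \<Sum>q<P. h (Suc q) k / den k) sums (\<Sum>q<P. shift_series a b (Suc q))"
      unfolding h_def den_def s_def by (intro sums_sum shift_series_sums) auto
    then show ?thesis
      unfolding f_def sum_divide_distrib by (simp add: sums_iff)
  qed
  ultimately show ?thesis
    unfolding sums_def mid_series_def den_def s_def by simp
qed

section \<open>Zeta series and the second formula\<close>

lemma rzeta_sums: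
  assumes "n \<ge> 2"
  shows "(\<lambda>q. 1 / real (Suc q) ^ n) sums rzeta n"
proof -
  have "summable (\<lambda>q. inverse (real (Suc q) ^ n))"
    using inverse_power_summable[OF assms, where ?'a = real] by (subst summable_Suc_iff)
  then show ?thesis
    unfolding rzeta_def by (intro summable_sums) (simp add: inverse_eq_divide)
qed

text \<open>Subtract twice the terms with even denominator base, which add up to zeta(n) /
  2^n.\<close>

lemma alternating_rzeta_sums:
  assumes "n \<ge> 2"
  shows "(\<lambda>q. (-1) ^ q / real (Suc q) ^ n) sums ((1 - 2 / 2 ^ n) * rzeta n)"
proof -
  let ?h = "\<lambda>q. if odd q then 2 / real (Suc q) ^ n else 0"
  have "(\<lambda>q. ?h (2 * q + 1)) sums (2 / 2 ^ n * rzeta n)"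
  proof -
    have "?h (2 * q + 1) = 2 / 2 ^ n * (1 / real (Suc q) ^ n)" for q
    proof -
      have "real (Suc (2 * q + 1)) = 2 * real (Suc q)" by simp
      then show ?thesis by (simp only: power_mult_distrib) simp
    qed
    then show ?thesis
      by (simp only:) (intro sums_mult rzeta_sums assms)
  qed
  moreover have "?h q = 0" if "q \<notin> range (\<lambda>q. 2 * q + 1)" for q
    using that by (metis oddE rangeI)
  ultimately have "?h sums (2 / 2 ^ n * rzeta n)"
    by (subst (asm) sums_mono_reindex) (auto simp: strict_mono_def)
  from sums_diff[OF rzeta_sums[OF assms] this]
  have "(\<lambda>q. 1 / real (Suc q) ^ n - ?h q) sums ((1 - 2 / 2 ^ n) * rzeta n)"
    by (simp add: algebra_simps)
  moreover have "1 / real (Suc q) ^ n - ?h q = (-1) ^ q / real (Suc q) ^ n" for q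
    by auto
  ultimately show ?thesis by simp
qed

text \<open>The finite sum over r in \<open>shift_series\<close> is summed over p term by term. For
  r = 0 the binomial with 2a vanishes since a \<ge> 1, and the one with 2b is 1 only for b = 0; the
  alternating harmonic series then yields the logarithm.\<close>

lemma mid_series_eq_rzeta_sum:
  assumes "a \<ge> 1"
  shows "mid_series (2 * a + 1) (2 * b + 1) =
     (\<Sum>r = 1..a + b. (1 / 2 ^ (2 * r)) * (real ((2 * r) choose (2 * a))
          + real ((2 * r) choose (2 * b)) * (1 - 1 / 2 ^ (2 * r)))
        * rzeta (2 * r + 1) * tval [(2 * a + 2 * b + 1 - 2 * r, True)])
     + (if b = 0 then ln 2 * tval [(2 * a + 1, True)] else 0)"
proof -
  define T where "T = (\<lambda>r. tval [(2 * a + 2 * b + 1 - 2 * r, True)])"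
  define G where "G = (\<lambda>r. (1 / 2 ^ (2 * r)) * (real ((2 * r) choose (2 * a))
          + real ((2 * r) choose (2 * b)) * (1 - 1 / 2 ^ (2 * r))) * rzeta (2 * r + 1) * T r)"
  define H where "H = (\<lambda>r. if r = 0 then (if b = 0 then ln 2 * T 0 else 0) else G r)"
  have "(\<lambda>q. (1 / (2 * real (Suc q))) ^ (2 * r + 1) *
     (real ((2 * r) choose (2 * a)) - (-1) ^ (Suc q) * real ((2 * r) choose (2 * b))) * (2 * T r)) sums H r" for r
  proof (cases "r = 0")
    case True
    define D where "D = (if b = 0 then T 0 else 0)"
    have "(1 / (2 * real (Suc q))) ^ (2 * r + 1) *
        (real ((2 * r) choose (2 * a)) - (-1) ^ (Suc q) * real ((2 * r) choose (2 * b))) * (2 * T r)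
      = (-1) ^ q / real (Suc q) * D" for q
      using True assms by (cases "b = 0") (simp_all add: binomial_eq_0 D_def del: of_nat_Suc)
    moreover have "(\<lambda>q. (-1) ^ q / real (Suc q) * D) sums (ln 2 * D)"
      by (rule sums_mult2[OF alternating_harmonic_series_sums])
    moreover have "H r = ln 2 * D"
      using True by (simp add: H_def D_def)
    ultimately show ?thesis by (simp only:)
  next
    case False
    define c where "c = 1 / 2 ^ (2 * r) * T r"
    define A where "A = real ((2 * r) choose (2 * a))"
    define B where "B = real ((2 * r) choose (2 * b))"
    have "(\<lambda>q. c * (A * (1 / real (Suc q) ^ (2 * r + 1)) + B * ((-1) ^ q / real (Suc q) ^ (2 * r + 1)))) sums
       (c * (A * rzeta (2 * r + 1) + B * ((1 - 2 / 2 ^ (2 * r + 1)) * rzeta (2 * r + 1))))"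
      using False by (intro sums_mult sums_add rzeta_sums alternating_rzeta_sums) auto
    moreover have "c * (A * (1 / real (Suc q) ^ (2 * r + 1)) + B * ((-1) ^ q / real (Suc q) ^ (2 * r + 1)))
      = (1 / (2 * real (Suc q))) ^ (2 * r + 1) * (A - (-1) ^ (Suc q) * B) * (2 * T r)" for q
    proof -
      \<comment> \<open>The separate division by 2 is cancelled by the factor 2 of
        \<open>2 * T r\<close>.\<close>
      have e: "(1 / (2 * real (Suc q))) ^ (2 * r + 1) = 1 / 2 ^ (2 * r) / 2 * (1 / real (Suc q) ^ (2 * r + 1))"
        by (simp only: power_one_over power_mult_distrib power_add power_one_right) simp
      show ?thesis unfolding e c_def by (simp add: add_divide_distrib algebra_simps del: of_nat_Suc)
    qed
    moreover have "c * (A * rzeta (2 * r + 1) + B * ((1 - 2 / 2 ^ (2 * r + 1)) * rzeta (2 * r + 1))) = H r"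
      using False unfolding H_def G_def c_def A_def[symmetric] B_def[symmetric] by (simp add: algebra_simps add_divide_distrib)
    ultimately show ?thesis unfolding A_def B_def by (simp only:)
  qed
  then have "(\<lambda>q. shift_series a b (Suc q)) sums (\<Sum>r\<le>a + b. H r)"
    unfolding shift_series_def T_def by (intro sums_sum)
  with shift_series_sums_mid_series[OF assms]
  have "mid_series (2 * a + 1) (2 * b + 1) = (\<Sum>r\<le>a + b. H r)"
    by (rule sums_unique2)
  also have "\<dots> = H 0 + (\<Sum>r = 1..a + b. H r)"
    by (simp add: atMost_atLeast0 sum.atLeast_Suc_atMost)
  also have "(\<Sum>r = 1..a + b. H r) = (\<Sum>r = 1..a + b. G r)"
    by (rule sum.cong) (auto simp: H_def)
  also have "H 0 = (if b = 0 then ln 2 * tval [(2 * a + 1, True)] else 0)"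
    by (simp add: H_def T_def)
  finally show ?thesis unfolding G_def T_def by simp
qed

theorem theorem4p3:
  fixes a b :: nat
  assumes "a \<ge> 1"
  shows "tstar (replicate a 2 @ [1] @ replicate b 2)
           = - 4 / pi * tval [(2*a + 2*b + 2, True)]
             - 8 / pi * tval [(2*a + 1, False), (2*b + 1, True)]
    \<and> tstar (replicate a 2 @ [1] @ replicate b 2)
           = - 4 / pi * (\<Sum>r = 1..a + b.
                 (1 / 2 ^ (2*r)) * (real ((2*r) choose (2*a))
                    + real ((2*r) choose (2*b)) * (1 - 1 / 2 ^ (2*r)))
                 * rzeta (2*r + 1) * tval [(2*a + 2*b + 1 - 2*r, True)])
             - (if b = 0 then 4 * ln 2 / pi * tval [(2*a + 1, True)] else 0)"
proof
  have "mid_series (2 * a + 1) (2 * b + 1) = tval [(2*a + 2*b + 2, True)] + 2 * tval [(2*a + 1, False), (2*b + 1, True)]"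
    using mid_series_eq_tval[of "2 * b + 1" "2 * a + 1"] assms by simp
  then show "tstar (replicate a 2 @ [1] @ replicate b 2)
           = - 4 / pi * tval [(2*a + 2*b + 2, True)]
             - 8 / pi * tval [(2*a + 1, False), (2*b + 1, True)]"
    unfolding tstar_eq_mid_series[OF assms] by (simp add: algebra_simps)
  show "tstar (replicate a 2 @ [1] @ replicate b 2)
           = - 4 / pi * (\<Sum>r = 1..a + b.
                 (1 / 2 ^ (2*r)) * (real ((2*r) choose (2*a))
                    + real ((2*r) choose (2*b)) * (1 - 1 / 2 ^ (2*r)))
                 * rzeta (2*r + 1) * tval [(2*a + 2*b + 1 - 2*r, True)])
             - (if b = 0 then 4 * ln 2 / pi * tval [(2*a + 1, True)] else 0)"
    unfolding tstar_eq_mid_series[OF assms] mid_series_eq_rzeta_sum[OF assms]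
    by (cases "b = 0") (simp_all only: distrib_left if_True if_False, simp_all)
qed

end
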